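(* If $h(x)=\sum_{k=0}^{\infty} a_k x^k$, then $$\int_0^{\frac{\pi}{2}} h(\sin x)\,dx=\int_0^{\frac{\pi}{2}} h(\cos x)\,dx=\frac{\pi}{2}a_0+a_1+\sum_{k=1}^{\infty}\left(\frac{\pi}{2}a_{2k}\,\frac{1\cdot 3\cdot\ldots\cdot(2k-1)}{2\cdot 4\cdot\ldots\cdot(2k)}+a_{2k+1}\,\frac{2\cdot 4\cdot\ldots\cdot(2k)}{1\cdot 3\cdot\ldots\cdot(2k+1)}\right).$$
   Context: Here $h$ is a function given by a power series in $x$ with coefficients $a_k$, $k\ge 0$. $1\cdot 3\cdot\ldots\cdot(2k-1)$ and $1\cdot 3\cdot\ldots\cdot(2k+1)$ denote the products of the first $k$ and first $k+1$ odd positive integers respectively, and $2\cdot 4\cdot\ldots\cdot(2k)$ the product of the first $k$ even positive integers. *)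

theory Defs
  imports "HOL-Analysis.Analysis"
begin

definition odd_prod :: "nat \<Rightarrow> nat" where
  "odd_prod k = (\<Prod>i=1..k. 2 * i - 1)"

definition even_prod :: "nat \<Rightarrow> nat" where
  "even_prod k = (\<Prod>i=1..k. 2 * i)"

text \<open>
  The even and odd powers are kept paired in one summand. The factors
  multiplying \<open>a (2 k)\<close> and \<open>a (2 k + 1)\<close> are the integrals of the powers \<open>2 k\<close> and \<open>2 k + 1\<close>
  of \<open>sin\<close> over \<open>[0, pi / 2]\<close>.
\<close>

definition series_term :: "(nat \<Rightarrow> real) \<Rightarrow> nat \<Rightarrow> real" where
  "series_term a k =
     pi / 2 * a (2 * k) * (real (odd_prod k) / real (even_prod k))
     + a (2 * k + 1) * (real (even_prod k) / real (odd_prod (k + 1)))"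

end

theory Submission
  imports Defs
begin

text \<open>
  Integrate the power series term by term. The hypothesis gives convergence on the closed
  interval \<open>{0..1}\<close> only, and at \<open>1\<close> it may be merely conditional, so there may be no
  summable majorant to justify the exchange of sum and integral. Abel's theorem in its
  uniform form (\<open>Abel_uniform_limit\<close>) takes its place: convergence at \<open>1\<close> makes the partial
  sums converge uniformly on all of \<open>{0..1}\<close>. As \<open>sin\<close> maps \<open>{0..pi/2}\<close> into \<open>{0..1}\<close>, the
  integral of \<open>h (sin x)\<close> is the sum of \<open>a k\<close> times the integral of \<open>sin x ^ k\<close>.

  Integration by parts reduces the exponent of \<open>sin x ^ k\<close> by two (\<open>has_integral_sin_power_step\<close>),
  which yields Wallis's formulas for even and odd exponents. Bracketing the convergent
  series in consecutive pairs gives the claimed series, and the reflection of \<open>x\<close>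
  to \<open>pi/2 - x\<close> transfers everything from \<open>sin\<close> to \<open>cos\<close>.
\<close>

section \<open>Abel's theorem on uniform convergence\<close>

text \<open>
  Summation by parts turns the sum into a combination of the partial sums of \<open>a\<close> with the
  nonnegative weights \<open>c k - c (Suc k)\<close> and the last \<open>c k\<close>, whose total telescopes to \<open>c 0\<close>.
\<close>

lemma Abel_inequality:
  fixes a c :: "nat \<Rightarrow> real"
  assumes bound: "\<And>n. \<bar>\<Sum>k<n. a k\<bar> \<le> e"
    and decreasing: "\<And>k. c (Suc k) \<le> c k" and nonneg: "\<And>k. 0 \<le> c k"
  shows "\<bar>\<Sum>k<n. a k * c k\<bar> \<le> e * c 0"
proof (cases n)
  case 0
  have "0 \<le> e" using bound[of 0] by simp
  then show ?thesis using 0 nonneg by simp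
next
  case (Suc m)
  define A where "A j = (\<Sum>k<j. a k)" for j
  have A: "\<bar>A j\<bar> \<le> e" for j
    using bound by (simp add: A_def)
  have "(\<Sum>k<Suc m. a k * c k) = A (Suc m) * c m + (\<Sum>k<m. A (Suc k) * (c k - c (Suc k)))"
    by (induction m) (simp_all add: A_def algebra_simps)
  also have "\<bar>\<dots>\<bar> \<le> \<bar>A (Suc m) * c m\<bar> + (\<Sum>k<m. \<bar>A (Suc k) * (c k - c (Suc k))\<bar>)"
    by (rule order_trans[OF abs_triangle_ineq add_left_mono[OF sum_abs]])
  also have "\<dots> \<le> e * c m + (\<Sum>k<m. e * (c k - c (Suc k)))"
    using A decreasing nonneg
    by (intro add_mono sum_mono) (simp_all add: abs_mult mult_right_mono)
  also have "\<dots> = e * c m + e * (c 0 - c m)"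
    by (simp only: sum_distrib_left[symmetric] sum_lessThan_telescope')
  also have "\<dots> = e * c 0"
    by (simp add: algebra_simps)
  finally show ?thesis using Suc by simp
qed

text \<open>
  The powers of a fixed \<open>x\<close> in \<open>{0..1}\<close> decrease from \<open>1\<close>, so a bound on the
  tails at \<open>1\<close> bounds the tails at \<open>x\<close>, uniformly in \<open>x\<close>.
\<close>

lemma Abel_uniform_limit:
  fixes a :: "nat \<Rightarrow> real"
  assumes sums: "\<And>x. x \<in> {0..1} \<Longrightarrow> (\<lambda>k. a k * x ^ k) sums h x"
  shows "uniform_limit {0..1} (\<lambda>n x. \<Sum>k<n. a k * x ^ k) h sequentially"
proof (rule uniform_limitI)
  fix e :: real assume "e > 0"
  have "summable a"
    using sums[of 1] by (simp add: sums_iff)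
  then obtain N where N: "\<bar>sum a {m..<n}\<bar> < e / 2" if "m \<ge> N" for m n
    using \<open>e > 0\<close> unfolding summable_Cauchy real_norm_def by (metis half_gt_zero)
  have "dist (\<Sum>k<m. a k * x ^ k) (h x) < e" if m: "m \<ge> N" and x: "x \<in> {0..1}" for m x
  proof -
    have tail: "\<bar>\<Sum>k<n. a (k + m) * x ^ (k + m)\<bar> \<le> e / 2" for n
    proof -
      have "\<bar>\<Sum>k<n. a (k + m)\<bar> \<le> e / 2" for n
      proof -
        have "(\<Sum>k<n. a (k + m)) = sum a {m..<n + m}"
          using sum.shift_bounds_nat_ivl[of a 0 m n] by (simp add: lessThan_atLeast0)
        then show ?thesis using N[OF m, of "n + m"] by simp
      qed
      then have "\<bar>\<Sum>k<n. a (k + m) * x ^ (k + m)\<bar> \<le> e / 2 * x ^ (0 + m)"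
        using x by (intro Abel_inequality) (auto intro: mult_left_le_one_le)
      also have "\<dots> \<le> e / 2"
        using x \<open>e > 0\<close> by (simp add: mult_left_le power_le_one)
      finally show ?thesis .
    qed
    have "(\<lambda>k. a (k + m) * x ^ (k + m)) sums (h x - (\<Sum>k<m. a k * x ^ k))"
      using sums_split_initial_segment[OF sums[OF x], of m] .
    then have "\<bar>h x - (\<Sum>k<m. a k * x ^ k)\<bar> \<le> e / 2"
      unfolding sums_def by (rule LIMSEQ_le_const2[OF tendsto_rabs]) (use tail in blast)
    then show ?thesis
      using \<open>e > 0\<close> by (simp add: dist_real_def abs_minus_commute)
  qed
  then show "\<forall>\<^sub>F n in sequentially. \<forall>x\<in>{0..1}. dist (\<Sum>k<n. a k * x ^ k) (h x) < e"
    unfolding eventually_sequentially by blast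
qed

text \<open>
  The sum \<open>J\<close> of the integrated series converges in the given order of its terms, possibly not
  absolutely: it is the limit of the integrals of the uniformly convergent partial sums.
\<close>

lemma power_series_comp_integral:
  fixes a :: "nat \<Rightarrow> real" and g :: "real \<Rightarrow> real"
  assumes sums: "\<And>x. x \<in> {0..1} \<Longrightarrow> (\<lambda>k. a k * x ^ k) sums h x"
    and cont: "continuous_on {u..v} g" and range: "g ` {u..v} \<subseteq> {0..1}"
    and powers: "\<And>k. ((\<lambda>x. g x ^ k) has_integral w k) {u..v}"
  obtains J where "((\<lambda>x. h (g x)) has_integral J) {u..v}" "(\<lambda>k. a k * w k) sums J"
proof -
  have "uniform_limit {u..v} (\<lambda>n x. \<Sum>k<n. a k * g x ^ k) (\<lambda>x. h (g x)) sequentially"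
    using uniform_limit_compose'[OF Abel_uniform_limit[OF sums], of g] range by auto
  then obtain I J
    where I: "\<And>n. ((\<lambda>x. \<Sum>k<n. a k * g x ^ k) has_integral I n) {u..v}"
      and J: "((\<lambda>x. h (g x)) has_integral J) {u..v}" and lim: "I \<longlonglongrightarrow> J"
    by (rule uniform_limit_integral) (auto intro!: continuous_intros cont)
  have "((\<lambda>x. \<Sum>k<n. a k * g x ^ k) has_integral (\<Sum>k<n. a k * w k)) {u..v}" for n
    by (intro has_integral_sum has_integral_mult_right powers) simp
  with I have "I = (\<lambda>n. \<Sum>k<n. a k * w k)"
    by (blast intro: has_integral_unique)
  with lim have "(\<lambda>k. a k * w k) sums J"
    by (simp add: sums_def)
  with J show ?thesis by (rule that)
qed

section \<open>Wallis's integrals\<close>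

text \<open>
  The boundary terms of \<open>- cos x * sin x ^ (n + 1)\<close> vanish at both ends, while its derivative
  is \<open>(n + 2) * sin x ^ (n + 2) - (n + 1) * sin x ^ n\<close>.
\<close>

lemma has_integral_sin_power_step:
  assumes "((\<lambda>x. sin x ^ n) has_integral I) {0..pi/2}"
  shows "((\<lambda>x. sin x ^ (n + 2)) has_integral (real n + 1) / (real n + 2) * I) {0..pi/2}"
proof -
  let ?F = "\<lambda>x::real. - cos x * sin x ^ (n + 1)"
  let ?f = "\<lambda>x::real. (real n + 2) * sin x ^ (n + 2) - (real n + 1) * sin x ^ n"
  have "(?F has_real_derivative ?f x) (at x within {0..pi/2})" for x
  proof -
    have "((\<lambda>x. sin x ^ (n + 1)) has_real_derivative (real n + 1) * (cos x * sin x ^ n))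
        (at x within {0..pi/2})"
      using DERIV_power_Suc[OF DERIV_subset[OF DERIV_sin subset_UNIV], of n]
      by (simp add: add_ac)
    from DERIV_mult[OF DERIV_minus[OF DERIV_subset[OF DERIV_cos subset_UNIV]] this]
    have "(?F has_real_derivative sin x * sin x ^ (n + 1)
        - (real n + 1) * (cos x * cos x) * sin x ^ n) (at x within {0..pi/2})"
      by (simp add: mult_ac)
    moreover have "cos x * cos x = 1 - sin x * sin x"
      using sin_cos_squared_add3[of x] by linarith
    ultimately show ?thesis
      by (simp add: algebra_simps)
  qed
  then have "(?f has_integral ?F (pi/2) - ?F 0) {0..pi/2}"
    by (intro fundamental_theorem_of_calculus)
      (simp_all flip: has_real_derivative_iff_has_vector_derivative)
  then have "(?f has_integral 0) {0..pi/2}"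
    by simp
  from has_integral_add[OF this has_integral_mult_right[OF assms, of "real n + 1"]]
  have "((\<lambda>x. (real n + 2) * sin x ^ (n + 2)) has_integral (real n + 1) * I) {0..pi/2}"
    by simp
  from has_integral_divide[OF this, of "real n + 2"]
  show ?thesis
    by (simp add: nonzero_mult_div_cancel_left[of "real n + 2"])
qed

lemma odd_prod_Suc: "odd_prod (Suc k) = (2 * k + 1) * odd_prod k"
  by (simp add: odd_prod_def)

lemma even_prod_Suc: "even_prod (Suc k) = (2 * k + 2) * even_prod k"
  by (simp add: even_prod_def)

lemma has_integral_sin_power_even:
  "((\<lambda>x. sin x ^ (2 * k)) has_integral pi / 2 * (real (odd_prod k) / real (even_prod k)))
     {0..pi/2}"
proof (induction k)
  case 0
  show ?case
    using has_integral_const_real[of "1::real" 0 "pi/2"] by (simp add: odd_prod_def even_prod_def)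
next
  case (Suc k)
  have ratio: "real (odd_prod (Suc k)) / real (even_prod (Suc k))
      = (real (2 * k) + 1) / (real (2 * k) + 2) * (real (odd_prod k) / real (even_prod k))"
    by (simp only: odd_prod_Suc even_prod_Suc of_nat_mult of_nat_add of_nat_numeral of_nat_1
        times_divide_times_eq)
  show ?case
    using has_integral_sin_power_step[OF Suc] unfolding ratio by (simp add: mult_ac)
qed

lemma has_integral_sin_power_odd:
  "((\<lambda>x. sin x ^ (2 * k + 1)) has_integral real (even_prod k) / real (odd_prod (k + 1)))
     {0..pi/2}"
proof (induction k)
  case 0
  have "(sin has_integral - cos (pi/2) - (- cos 0)) {0..pi/2}"
    by (intro fundamental_theorem_of_calculus)
      (auto intro!: derivative_eq_intros
        simp flip: has_real_derivative_iff_has_vector_derivative)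
  then show ?case
    by (simp add: odd_prod_def even_prod_def)
next
  case (Suc k)
  have "(real (2 * k + 1) + 1) / (real (2 * k + 1) + 2)
        * (real (even_prod k) / real (odd_prod (k + 1)))
      = real (even_prod (Suc k)) / real (odd_prod (Suc k + 1))"
    by (simp add: odd_prod_Suc even_prod_Suc algebra_simps)
  with has_integral_sin_power_step[OF Suc] show ?case
    by simp
qed

lemma has_integral_sin_imp_cos:
  fixes f :: "real \<Rightarrow> real"
  assumes "((\<lambda>x. f (sin x)) has_integral I) {0..pi/2}"
  shows "((\<lambda>x. f (cos x)) has_integral I) {0..pi/2}"
proof -
  have "((\<lambda>x. f (sin (pi/2 - x))) has_integral I) {0..pi/2}"
    using has_integral_affinity[of "\<lambda>x. f (sin x)" I 0 "pi/2" "-1" "pi/2"] assms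
    by simp
  then show ?thesis
    by (simp only: cos_sin_eq of_real_eq_id id_apply)
qed

section \<open>Integrals of power series in sine and cosine\<close>

theorem theorem5:
  fixes h :: "real \<Rightarrow> real" and a :: "nat \<Rightarrow> real"
  assumes "\<And>x. x \<in> {0..1} \<Longrightarrow> (\<lambda>k. a k * x ^ k) sums h x"
  shows "(\<lambda>x. h (sin x)) integrable_on {0..pi/2}
    \<and> (\<lambda>x. h (cos x)) integrable_on {0..pi/2}
    \<and> summable (\<lambda>k. series_term a (Suc k))
    \<and> integral {0..pi/2} (\<lambda>x. h (sin x)) = integral {0..pi/2} (\<lambda>x. h (cos x))
    \<and> integral {0..pi/2} (\<lambda>x. h (cos x)) =
        pi / 2 * a 0 + a 1 + (\<Sum>k. series_term a (Suc k))"
proof -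
  define w where "w n = integral {0..pi/2} (\<lambda>x. sin x ^ n)" for n :: nat
  have w: "((\<lambda>x. sin x ^ n) has_integral w n) {0..pi/2}" for n
    unfolding w_def
    by (intro integrable_integral integrable_continuous_real continuous_intros)
  have w_even: "w (2 * k) = pi / 2 * (real (odd_prod k) / real (even_prod k))" for k
    unfolding w_def by (rule integral_unique[OF has_integral_sin_power_even])
  have w_odd: "w (2 * k + 1) = real (even_prod k) / real (odd_prod (k + 1))" for k
    unfolding w_def by (rule integral_unique[OF has_integral_sin_power_odd])
  have range: "sin ` {0..pi/2} \<subseteq> {0..1::real}"
    by (auto intro!: sin_ge_zero)
  have cont: "continuous_on {0..pi/2} (sin :: real \<Rightarrow> real)"
    by (intro continuous_intros)
  obtain J where sin: "((\<lambda>x. h (sin x)) has_integral J) {0..pi/2}"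
    and J: "(\<lambda>k. a k * w k) sums J"
    by (rule power_series_comp_integral[OF assms cont range w])
  have cos: "((\<lambda>x. h (cos x)) has_integral J) {0..pi/2}"
    by (rule has_integral_sin_imp_cos[OF sin])
  \<comment> \<open>Bracketing consecutive terms, unlike rearranging them, is safe for a conditionally
    convergent series.\<close>
  have "(\<Sum>n\<in>{k * 2..<k * 2 + 2}. a n * w n) = series_term a k" for k
  proof -
    have "{k * 2..<k * 2 + 2} = {2 * k, 2 * k + 1}" by auto
    then show ?thesis
      by (simp add: series_term_def w_even w_odd[simplified])
  qed
  then have "(series_term a) sums J"
    using sums_group[OF J, of 2] by simp
  moreover have "series_term a 0 = pi / 2 * a 0 + a 1"
    by (simp add: series_term_def odd_prod_def even_prod_def)
  ultimately have "(\<lambda>k. series_term a (Suc k)) sums (J - (pi / 2 * a 0 + a 1))"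
    by (simp add: sums_Suc_iff)
  with sin cos show ?thesis
    by (auto simp: sums_iff integral_unique)
qed

end
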